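(* Let $G$ be a finite group with $|\pi(Z(G))|\geq 2$. Then the deleted enhanced power graph $\mathcal{G}^*_e(G)$ is connected.
   Context: For a group $G$, the enhanced power graph $\mathcal{G}_e(G)$ is the simple undirected graph with vertex set $G$ in which two distinct vertices $x,y$ are adjacent if there exists $z\in G$ with $x=z^m$ and $y=z^n$ for some $m,n\in\mathbb{N}$. The deleted enhanced power graph $\mathcal{G}^*_e(G)$ is the induced subgraph of $\mathcal{G}_e(G)$ on $G\setminus\{e\}$. $Z(G)$ is the center of $G$, and for a finite group $H$, $\pi(H)$ is the set of primes dividing $|H|$. *)

theory Defs
  imports
    "HOL-Algebra.Coset"
    "HOL-Computational_Algebra.Primes"
    "Graph_Theory.Graph_Theory"
begin

definition center :: "('a, 'b) monoid_scheme \<Rightarrow> 'a set" where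
  "center G = {z \<in> carrier G. \<forall>g \<in> carrier G. z \<otimes>\<^bsub>G\<^esub> g = g \<otimes>\<^bsub>G\<^esub> z}"

definition center_group :: "('a, 'b) monoid_scheme \<Rightarrow> ('a, 'b) monoid_scheme" where
  "center_group G = G\<lparr>carrier := center G\<rparr>"

text \<open>The set \<open>\<pi>(H)\<close>; it is meant for finite \<open>H\<close> only, since \<open>order H = 0\<close> when \<open>H\<close> is infinite.\<close>

definition order_primes :: "('a, 'b) monoid_scheme \<Rightarrow> nat set" where
  "order_primes H = {p. prime p \<and> p dvd order H}"

text \<open>
  A simple undirected graph is represented as a symmetric loop-free digraph whose arcs are
  pairs of vertices. The exponents range over all of \<open>nat\<close>; admitting the exponent \<open>0\<close> can only
  affect arcs at the identity, and in a finite group it makes no difference at all.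
\<close>

definition enhanced_power_graph :: "('a, 'b) monoid_scheme \<Rightarrow> 'a pair_pre_digraph" where
  "enhanced_power_graph G =
     \<lparr> pverts = carrier G,
       parcs = {(x, y). x \<in> carrier G \<and> y \<in> carrier G \<and> x \<noteq> y \<and>
         (\<exists>z \<in> carrier G. \<exists>(m::nat) (n::nat). x = z [^]\<^bsub>G\<^esub> m \<and> y = z [^]\<^bsub>G\<^esub> n)} \<rparr>"

definition deleted_enhanced_power_graph ::
    "('a, 'b) monoid_scheme \<Rightarrow> ('a, 'a \<times> 'a) pre_digraph" where
  "deleted_enhanced_power_graph G =
     with_proj (enhanced_power_graph G) \<restriction> (carrier G - {\<one>\<^bsub>G\<^esub>})"

lemma (in group) subgroup_center: "subgroup (center G) G"
proof (rule subgroupI)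
  show "center G \<subseteq> carrier G" "center G \<noteq> {}"
    by (auto simp: center_def intro!: exI[of _ \<one>])
next
  fix a assume a: "a \<in> center G"
  then have ac: "a \<in> carrier G" by (simp add: center_def)
  have "inv a \<otimes> g = g \<otimes> inv a" if g: "g \<in> carrier G" for g
  proof -
    have "g \<otimes> a = a \<otimes> g" using a g by (simp add: center_def)
    then have "inv a \<otimes> (g \<otimes> a) = g" using ac g by (simp add: m_assoc[symmetric])
    then have "inv a \<otimes> g \<otimes> a = g" using ac g by (simp add: m_assoc)
    then show ?thesis using ac g inv_solve_right[of "inv a \<otimes> g" g a] by simp
  qed
  then show "inv a \<in> center G" using ac by (simp add: center_def)
next
  fix a b assume a: "a \<in> center G" and b: "b \<in> center G"
  then have c: "a \<in> carrier G" "b \<in> carrier G" by (simp_all add: center_def)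
  have "a \<otimes> b \<otimes> g = g \<otimes> (a \<otimes> b)" if g: "g \<in> carrier G" for g
  proof -
    have "a \<otimes> b \<otimes> g = a \<otimes> (b \<otimes> g)" using c g by (simp add: m_assoc)
    also have "b \<otimes> g = g \<otimes> b" using b g by (simp add: center_def)
    also have "a \<otimes> (g \<otimes> b) = a \<otimes> g \<otimes> b" using c g by (simp add: m_assoc)
    also have "a \<otimes> g = g \<otimes> a" using a g by (simp add: center_def)
    also have "g \<otimes> a \<otimes> b = g \<otimes> (a \<otimes> b)" using c g by (simp add: m_assoc)
    finally show ?thesis .
  qed
  then show "a \<otimes> b \<in> center G" using c by (simp add: center_def)
qed

lemma pair_bidirected_enhanced_power_graph: "pair_bidirected_digraph (enhanced_power_graph G)"
  by unfold_locales (auto simp: enhanced_power_graph_def symmetric_def sym_def)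

end

theory Submission
  imports Defs "HOL-Algebra.Multiplicative_Group" "HOL-Algebra.Sylow"
begin

text \<open>
  Commuting elements of coprime orders are both powers of their product. Hence, for central
  elements \<open>a\<close> and \<open>b\<close> of distinct prime orders \<open>p\<close> and \<open>q\<close>, every \<open>x \<noteq> \<one>\<close> has a power of prime
  order which is adjacent (or equal) to \<open>a\<close> or to \<open>b\<close>, and \<open>a\<close> and \<open>b\<close> are themselves adjacent.
\<close>

text \<open>Cauchy's theorem, as the case of exponent 1 in Sylow's theorem, where the cofactor
  \<open>m\<close> may itself be divisible by \<open>p\<close>. In a subgroup with \<open>p\<close>
  elements, every element other than \<open>\<one>\<close> has order \<open>p\<close>.\<close>

lemma (in group) exists_ord_prime:
  assumes "finite (carrier G)" "prime p" "p dvd order G"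
  shows "\<exists>a \<in> carrier G. ord a = p"
proof -
  obtain m where m: "order G = p ^ 1 * m" using assms(3) by (auto simp: dvd_def)
  obtain H where H: "subgroup H G" "card H = p"
    using sylow_thm[OF \<open>prime p\<close> group_axioms m assms(1)] by auto
  have "\<not> H \<subseteq> {\<one>}"
  proof
    assume "H \<subseteq> {\<one>}"
    then have "card H \<le> card {\<one>}" by (intro card_mono) auto
    then show False using H(2) prime_gt_1_nat[OF \<open>prime p\<close>] by simp
  qed
  then obtain a where a: "a \<in> H" "a \<noteq> \<one>" by blast
  interpret H: group "G\<lparr>carrier := H\<rparr>" by (rule subgroup.subgroup_is_group[OF H(1) group_axioms])
  have aG: "a \<in> carrier G" using a(1) H(1) subgroup.mem_carrier by metis
  have "a [^]\<^bsub>G\<lparr>carrier := H\<rparr>\<^esub> order (G\<lparr>carrier := H\<rparr>) = \<one>"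
    using H.pow_order_eq_1 a(1) by simp
  then have "a [^] p = \<one>"
    by (simp add: order_def H(2) flip: nat_pow_consistent)
  then have "ord a dvd p" using pow_eq_id[OF aG] by blast
  moreover have "ord a \<noteq> 1" using ord_eq_1[OF aG] a(2) by blast
  ultimately show ?thesis using \<open>prime p\<close> aG prime_nat_iff by blast
qed

lemma (in group) exists_central_ord_prime:
  assumes "finite (carrier G)" "p \<in> order_primes (center_group G)"
  shows "\<exists>a \<in> center G. ord a = p"
proof -
  interpret Z: group "center_group G"
    unfolding center_group_def
    by (rule subgroup.subgroup_is_group[OF subgroup_center group_axioms])
  have "finite (carrier (center_group G))"
    using assms(1) by (auto simp: center_group_def center_def)
  then obtain a where a: "a \<in> carrier (center_group G)" "Z.ord a = p"
    using Z.exists_ord_prime assms(2) by (auto simp: order_primes_def)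
  then have aZ: "a \<in> center G" "a \<in> carrier G" by (auto simp: center_group_def center_def)
  \<comment> \<open>The center inherits its powers from \<open>G\<close>, so the same exponents send
    \<open>a\<close> to \<open>\<one>\<close> in both groups, and these exponents determine the
    order.\<close>
  have "ord a = Z.ord a"
  proof (rule ord_unique[OF aZ(2), THEN iffD2], intro allI)
    fix n
    show "(a [^] n = \<one>) = (Z.ord a dvd n)"
      using Z.pow_eq_id[OF a(1), of n] by (simp add: center_group_def flip: nat_pow_consistent)
  qed
  then show ?thesis using a(2) aZ(1) by blast
qed

text \<open>For any prime \<open>r\<close> dividing \<open>ord x\<close>, the exponent
  \<open>ord x div r\<close> gives an element of order \<open>r\<close>. Finiteness makes
  \<open>ord x\<close> positive.\<close>

lemma (in group) exists_pow_ord_prime: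
  assumes "finite (carrier G)" "x \<in> carrier G" "x \<noteq> \<one>"
  shows "\<exists>n::nat. prime (ord (x [^] n))"
proof -
  have "ord x \<noteq> 1" "ord x \<ge> 1" using ord_eq_1 ord_ge_1 assms by auto
  then obtain r where r: "prime r" "r dvd ord x" using prime_factor_nat by blast
  have "ord x div r \<noteq> 0" "ord x div r dvd ord x" "ord x div (ord x div r) = r"
    using r \<open>ord x \<ge> 1\<close> by (auto elim!: dvdE)
  then have "ord (x [^] (ord x div r)) = r" using ord_pow[OF assms(2)] by simp
  then show ?thesis using r(1) by metis
qed

lemma (in group) commuting_coprime_eq_pow_mult:
  assumes "x \<in> carrier G" "y \<in> carrier G" "x \<otimes> y = y \<otimes> x"
    and "coprime (ord x) (ord y)" "ord y \<noteq> 0"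
  shows "\<exists>n::nat. x = (x \<otimes> y) [^] n"
proof -
  \<comment> \<open>Bezout yields an exponent that is 0 modulo \<open>ord y\<close> and 1 modulo
    \<open>ord x\<close>: raising the product to it removes \<open>y\<close> and leaves
    \<open>x\<close>.\<close>
  obtain s t where st: "ord y * s = ord x * t + 1"
    using bezout_nat[OF assms(5), of "ord x"] assms(4)
    by (metis coprime_iff_gcd_eq_1 gcd.commute)
  have "(x \<otimes> y) [^] (ord y * s) = x [^] (ord y * s) \<otimes> y [^] (ord y * s)"
    by (rule pow_mult_distrib[OF assms(3,1,2)])
  also have "\<dots> = x [^] (ord x * t + 1) \<otimes> y [^] (ord y * s)"
    unfolding st ..
  also have "\<dots> = x"
    using assms(1,2) by (simp add: nat_pow_mult[symmetric] nat_pow_pow[symmetric])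
  finally show ?thesis by metis
qed

text \<open>Reachability is taken in \<open>mk_symmetric\<close> because \<open>connected\<close>
  means strong connectivity of that graph. Allowing \<open>x = y\<close>, where there is no arc,
  spares later case distinctions.\<close>

lemma (in group) reachable_deleted_enhanced_power_graph:
  fixes m n :: nat
  assumes "x \<in> carrier G - {\<one>}" "y \<in> carrier G - {\<one>}" "z \<in> carrier G"
    and "x = z [^] m" "y = z [^] n"
  shows "x \<rightarrow>\<^sup>*\<^bsub>mk_symmetric (deleted_enhanced_power_graph G)\<^esub> y"
proof (cases "x = y")
  case True
  then show ?thesis
    using assms(1) by (simp add: reachable_def deleted_enhanced_power_graph_def)
next
  case False
  have "(x, y) \<in> parcs (enhanced_power_graph G)"
    using False assms by (auto simp: enhanced_power_graph_def)
  then have "(x, y) \<in> parcs (mk_symmetric (deleted_enhanced_power_graph G))"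
    using assms(1,2)
    by (force simp: deleted_enhanced_power_graph_def induce_subgraph_def parcs_mk_symmetric)
  then show ?thesis
    using assms(1,2) unfolding reachable_def
    by (intro rtrancl_on_into_rtrancl_on[OF rtrancl_on_refl])
      (auto simp: deleted_enhanced_power_graph_def)
qed

lemma (in group) reachable_commuting_coprime:
  assumes "x \<in> carrier G - {\<one>}" "y \<in> carrier G - {\<one>}" "x \<otimes> y = y \<otimes> x"
    and "coprime (ord x) (ord y)" "ord x \<noteq> 0" "ord y \<noteq> 0"
  shows "x \<rightarrow>\<^sup>*\<^bsub>mk_symmetric (deleted_enhanced_power_graph G)\<^esub> y"
proof -
  obtain m :: nat where "x = (x \<otimes> y) [^] m"
    using commuting_coprime_eq_pow_mult[of x y] assms by auto
  moreover obtain n :: nat where "y = (x \<otimes> y) [^] n"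
    using commuting_coprime_eq_pow_mult[of y x] assms by (auto simp: coprime_commute)
  ultimately show ?thesis
    using assms(1,2) by (intro reachable_deleted_enhanced_power_graph[of _ _ "x \<otimes> y"]) auto
qed

theorem theorem5p2:
  fixes G :: "('a, 'b) monoid_scheme"
  assumes "group G"
    and "finite (carrier G)"
    and "card (order_primes (center_group G)) \<ge> 2"
  shows "Digraph_Component.connected (deleted_enhanced_power_graph G)"
proof -
  interpret group G by fact
  let ?H = "mk_symmetric (deleted_enhanced_power_graph G)"
  have verts: "pverts ?H = carrier G - {\<one>\<^bsub>G\<^esub>}"
    by (simp add: deleted_enhanced_power_graph_def)
  have trans: "u \<rightarrow>\<^sup>*\<^bsub>?H\<^esub> w" if "u \<rightarrow>\<^sup>*\<^bsub>?H\<^esub> v" "v \<rightarrow>\<^sup>*\<^bsub>?H\<^esub> w" for u v w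
    using that unfolding reachable_def by (rule rtrancl_on_trans)
  have sym: "v \<rightarrow>\<^sup>*\<^bsub>?H\<^esub> u" if "u \<rightarrow>\<^sup>*\<^bsub>?H\<^esub> v" for u v
    using symmetric_mk_symmetric that by (rule symmetric_reachable)
  obtain p q where pq: "p \<in> order_primes (center_group G)" "q \<in> order_primes (center_group G)" "p \<noteq> q"
    using assms(3) by (auto simp: numeral_2_eq_2 card_le_Suc_iff)
  then have prime: "prime p" "prime q" by (auto simp: order_primes_def)
  obtain a b where ab: "a \<in> center G" "ord a = p" "b \<in> center G" "ord b = q"
    using exists_central_ord_prime assms(2) pq by metis
  \<comment> \<open>The identity has order 1, which is not prime.\<close>
  have nontrivial: "c \<in> carrier G - {\<one>\<^bsub>G\<^esub>}" if "c \<in> carrier G" "prime (ord c)" for c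
    using that by auto
  have ord_0: "ord c \<noteq> 0" if "c \<in> carrier G" for c using ord_ge_1[OF assms(2) that] by simp
  \<comment> \<open>Centrality of \<open>c\<close> makes it commute with the arbitrary element
    \<open>y\<close>, and distinct prime orders are coprime.\<close>
  have reach_center: "y \<rightarrow>\<^sup>*\<^bsub>?H\<^esub> c"
    if "y \<in> carrier G" "prime (ord y)" "c \<in> center G" "prime (ord c)" "ord y \<noteq> ord c" for y c
  proof -
    have c: "c \<in> carrier G" and yc: "y \<otimes>\<^bsub>G\<^esub> c = c \<otimes>\<^bsub>G\<^esub> y"
      using that(1,3) by (simp_all add: center_def)
    show ?thesis
      by (rule reachable_commuting_coprime[OF nontrivial[OF that(1,2)] nontrivial[OF c that(4)] yc
            primes_coprime[OF that(2,4,5)] ord_0[OF that(1)] ord_0[OF c]])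
  qed
  have a: "a \<in> carrier G - {\<one>\<^bsub>G\<^esub>}" and b: "b \<in> carrier G"
    using ab prime nontrivial by (auto simp: center_def)
  have b_a: "b \<rightarrow>\<^sup>*\<^bsub>?H\<^esub> a"
    using reach_center[OF b _ ab(1)] ab(2,4) prime pq(3) by simp
  have to_a: "x \<rightarrow>\<^sup>*\<^bsub>?H\<^esub> a" if x: "x \<in> carrier G - {\<one>\<^bsub>G\<^esub>}" for x
  proof -
    obtain n :: nat where n: "prime (ord (x [^]\<^bsub>G\<^esub> n))"
      using exists_pow_ord_prime[OF assms(2)] x by blast
    define y where "y = x [^]\<^bsub>G\<^esub> n"
    have y: "y \<in> carrier G" "prime (ord y)"
      using n x by (auto simp: y_def)
    have "x \<rightarrow>\<^sup>*\<^bsub>?H\<^esub> y"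
      using x nontrivial[OF y] by (intro reachable_deleted_enhanced_power_graph[of _ _ x 1 n]) (auto simp: y_def)
    moreover have "y \<rightarrow>\<^sup>*\<^bsub>?H\<^esub> a"
    \<comment> \<open>If \<open>y\<close> has the same order as \<open>a\<close>, coprimality fails;
      but then \<open>ord y\<close> differs from \<open>q\<close>, and the path makes a detour
      through \<open>b\<close>.\<close>
    proof (cases "ord y = p")
      case True
      then have "y \<rightarrow>\<^sup>*\<^bsub>?H\<^esub> b"
        using reach_center[OF y ab(3)] ab(4) prime(2) pq(3) by simp
      then show ?thesis using b_a by (rule trans)
    next
      case False
      then show ?thesis using reach_center[OF y ab(1)] ab(2) prime(1) by simp
    qed
    ultimately show ?thesis by (rule trans)
  qed
  \<comment> \<open>The vertex \<open>a\<close> is a hub: go from \<open>u\<close> to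
    \<open>a\<close>, then follow the path from \<open>v\<close> to \<open>a\<close> backwards. It
    also shows that the vertex set is not empty.\<close>
  have "strongly_connected ?H"
  proof (rule strongly_connectedI)
    show "verts ?H \<noteq> {}" using verts a by auto
    fix u v assume "u \<in> verts ?H" "v \<in> verts ?H"
    then have "u \<rightarrow>\<^sup>*\<^bsub>?H\<^esub> a" "v \<rightarrow>\<^sup>*\<^bsub>?H\<^esub> a" using verts to_a by auto
    then show "u \<rightarrow>\<^sup>*\<^bsub>?H\<^esub> v" using trans sym by blast
  qed
  then show ?thesis by (simp add: connected_def)
qed

end
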